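(* Let $k$ be a positive integer, let $\mathcal{G}$ be a hereditary class of graphs, and let $G$ be a graph in $\mathcal{G}^k$. Then at least one of the following holds: (1) $G \in \mathcal{G}$; (2) $G$ admits a cut-partition $(A,B,C)$ such that $G[A \cup C] \in \mathcal{G}$ and $|C| \leq 2k^2-1$; (3) $G$ has a vertex of degree at most $2k^2-1$.
   Context: All graphs are finite, simple, and non-null. A class of graphs is hereditary if it is closed under taking induced subgraphs and under isomorphism. A graph $G$ is obtained from graphs $G_1$ and $G_2$ by gluing along at most $k$ vertices if $G_1[V(G_1)\cap V(G_2)] = G_2[V(G_1)\cap V(G_2)]$, $|V(G_1)\cap V(G_2)| \leq k$, and $G = G_1 \cup G_2$ (the intersection may be empty). For a class $\mathcal{G}$ of graphs, the $k$-closure $\mathcal{G}^k$ is the inclusion-wise smallest class that includes $\mathcal{G}$ and is closed under the operation of gluing along at most $k$ vertices. A cut-partition of a graph $G$ is a partition $(A,B,C)$ of $V(G)$ such that $A$ and $B$ are non-empty ($C$ may be empty) and there are no edges of $G$ between $A$ and $B$. *)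

theory Defs
  imports Main
begin

record 'a graph =
  verts :: "'a set"
  edges :: "'a set set"

text \<open>Finite, simple, non-null graphs.\<close>

definition is_graph :: "'a graph \<Rightarrow> bool" where
  "is_graph G \<longleftrightarrow> finite (verts G) \<and> verts G \<noteq> {} \<and>
     (\<forall>e\<in>edges G. e \<subseteq> verts G \<and> card e = 2)"

text \<open>The induced subgraph on \<open>S\<close> is only meant for \<open>S \<subseteq> verts G\<close>. For empty \<open>S\<close> it is the
  null graph, which does not satisfy \<^const>\<open>is_graph\<close>.\<close>

definition induced :: "'a graph \<Rightarrow> 'a set \<Rightarrow> 'a graph" where
  "induced G S = \<lparr>verts = S, edges = {e \<in> edges G. e \<subseteq> S}\<rparr>"

definition isomorphic :: "'a graph \<Rightarrow> 'a graph \<Rightarrow> bool" where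
  "isomorphic G H \<longleftrightarrow> (\<exists>f. bij_betw f (verts G) (verts H) \<and>
     (\<forall>u\<in>verts G. \<forall>v\<in>verts G. {u, v} \<in> edges G \<longleftrightarrow> {f u, f v} \<in> edges H))"

definition degree :: "'a graph \<Rightarrow> 'a \<Rightarrow> nat" where
  "degree G v = card {e \<in> edges G. v \<in> e}"

text \<open>A class of graphs is a set of graphs whose vertices are drawn from an arbitrary type \<open>'a\<close>.
  Gluing never renames vertices, so the vertex sets occurring in a construction of a
  graph by gluing are all subsets of its vertex set.\<close>

definition hereditary :: "'a graph set \<Rightarrow> bool" where
  "hereditary \<G> \<longleftrightarrow>
     (\<forall>G\<in>\<G>. is_graph G) \<and>
     (\<forall>G\<in>\<G>. \<forall>S. S \<subseteq> verts G \<and> S \<noteq> {} \<longrightarrow> induced G S \<in> \<G>) \<and>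
     (\<forall>G\<in>\<G>. \<forall>H. is_graph H \<and> isomorphic G H \<longrightarrow> H \<in> \<G>)"

definition glued :: "nat \<Rightarrow> 'a graph \<Rightarrow> 'a graph \<Rightarrow> 'a graph \<Rightarrow> bool" where
  "glued k G\<^sub>1 G\<^sub>2 G \<longleftrightarrow>
     induced G\<^sub>1 (verts G\<^sub>1 \<inter> verts G\<^sub>2) = induced G\<^sub>2 (verts G\<^sub>1 \<inter> verts G\<^sub>2) \<and>
     card (verts G\<^sub>1 \<inter> verts G\<^sub>2) \<le> k \<and>
     G = \<lparr>verts = verts G\<^sub>1 \<union> verts G\<^sub>2, edges = edges G\<^sub>1 \<union> edges G\<^sub>2\<rparr>"

inductive_set closure :: "nat \<Rightarrow> 'a graph set \<Rightarrow> 'a graph set"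
  for k :: nat and \<G> :: "'a graph set" where
  base: "G \<in> \<G> \<Longrightarrow> G \<in> closure k \<G>"
| glue: "G\<^sub>1 \<in> closure k \<G> \<Longrightarrow> G\<^sub>2 \<in> closure k \<G> \<Longrightarrow> glued k G\<^sub>1 G\<^sub>2 G \<Longrightarrow> G \<in> closure k \<G>"

definition cut_partition :: "'a graph \<Rightarrow> 'a set \<Rightarrow> 'a set \<Rightarrow> 'a set \<Rightarrow> bool" where
  "cut_partition G A B C \<longleftrightarrow>
     A \<union> B \<union> C = verts G \<and> A \<inter> B = {} \<and> A \<inter> C = {} \<and> B \<inter> C = {} \<and>
     A \<noteq> {} \<and> B \<noteq> {} \<and>
     (\<forall>a\<in>A. \<forall>b\<in>B. {a, b} \<notin> edges G)"

end

theory Submission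
  imports Defs
begin

text \<open>
  Write \<open>n = 2 * k\<^sup>2\<close> and suppose that every vertex of \<open>G\<close> has degree at least \<open>n\<close>. The proof
  finds a vertex set \<open>S\<close> that has some vertex with all its neighbours in \<open>S\<close>, has fewer than \<open>n\<close>
  vertices with a neighbour outside \<open>S\<close>, and induces a subgraph without a cutset of size at
  most \<open>k\<close>. An induced subgraph of a graph in the closure is either in \<open>\<G>\<close> or separated by the
  at most \<open>k\<close> vertices of some gluing (\<open>induced_closure_cases\<close>), so \<open>S\<close> induces a
  member of \<open>\<G>\<close>. Either \<open>S\<close> is the whole vertex set, or its interior, its complement and its
  boundary form the desired cut-partition.

  The set \<open>S\<close> is a smallest set with non-empty interior whose boundary is light. The
  size of the boundary is the wrong measure: cutting along \<open>C\<close> may turn up to \<open>k\<close> new vertices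
  into boundary vertices while it discards a single old one. Instead, a vertex of \<open>S\<close> with \<open>d\<close>
  neighbours outside \<open>S\<close> has weight \<open>min k d\<close>, which is positive exactly on the boundary, and a
  set is light if its total weight is less than \<open>n\<close>. Let \<open>(A, B, C)\<close> be a cut-partition of a
  light set \<open>S\<close> with non-empty interior, and let \<open>|C| \<le> k\<close>. The sides \<open>A\<close> and \<open>B\<close> cannot both lie in the boundary
  (\<open>not_both_sides_in_boundary\<close>).
  If neither does, the side of smaller weight weighs less than \<open>k\<^sup>2\<close>, and together
  with \<open>C\<close>, which weighs at most \<open>k * k\<close>, it is again light. If only \<open>B\<close> lies in the boundary,
  then each vertex of \<open>B\<close> has full weight \<open>k\<close>, or else \<open>B\<close> is large because of the degrees;
  in both cases \<open>B\<close> weighs at least as much as its removal adds to \<open>C\<close>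
  (\<open>boundary_side_heavy\<close>), so \<open>A \<union> C\<close> is again light. Hence a smallest such \<open>S\<close> has no such
  cut-partition.
\<close>

section \<open>Neighbours and boundaries\<close>

definition neighbours :: "'a graph \<Rightarrow> 'a \<Rightarrow> 'a set" where
  "neighbours G v = {u. {u, v} \<in> edges G}"

definition boundary :: "'a graph \<Rightarrow> 'a set \<Rightarrow> 'a set" where
  "boundary G S = {v \<in> S. \<not> neighbours G v \<subseteq> S}"

text \<open>The weight is taken over a part \<open>X\<close> of \<open>S\<close>, because the argument compares the
  contributions of the parts of a cut-partition.\<close>

definition weight :: "nat \<Rightarrow> 'a graph \<Rightarrow> 'a set \<Rightarrow> 'a set \<Rightarrow> nat" where
  "weight k G S X = (\<Sum>v\<in>X. min k (card (neighbours G v - S)))"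

lemma neighbours_subset:
  assumes "is_graph G"
  shows "neighbours G v \<subseteq> verts G"
  using assms unfolding neighbours_def is_graph_def by auto

lemma finite_neighbours:
  assumes "is_graph G"
  shows "finite (neighbours G v)"
  using neighbours_subset[OF assms] by (rule finite_subset) (use assms in \<open>simp add: is_graph_def\<close>)

lemma not_self_neighbour:
  assumes "is_graph G"
  shows "v \<notin> neighbours G v"
proof
  assume "v \<in> neighbours G v"
  then have "card {v, v} = 2" using assms unfolding neighbours_def is_graph_def by blast
  then show False by simp
qed

lemma degree_eq_card_neighbours:
  assumes "is_graph G"
  shows "degree G v = card (neighbours G v)"
proof -
  have "bij_betw (\<lambda>u. {u, v}) (neighbours G v) {e \<in> edges G. v \<in> e}"
    unfolding bij_betw_def
  proof
    show "inj_on (\<lambda>u. {u, v}) (neighbours G v)"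
      by (auto simp: inj_on_def doubleton_eq_iff)
    have "\<exists>u. e = {u, v}" if "e \<in> edges G" "v \<in> e" for e
    proof -
      have "card e = 2" using assms that unfolding is_graph_def by auto
      then show ?thesis using that(2) by (auto simp: card_2_iff)
    qed
    then show "(\<lambda>u. {u, v}) ` neighbours G v = {e \<in> edges G. v \<in> e}"
      unfolding neighbours_def by blast
  qed
  then show ?thesis unfolding degree_def by (simp add: bij_betw_same_card)
qed

lemma weight_Un:
  assumes "finite X" "finite Y" "X \<inter> Y = {}"
  shows "weight k G S (X \<union> Y) = weight k G S X + weight k G S Y"
  using assms unfolding weight_def by (rule sum.union_disjoint)

lemma weight_le: "weight k G S X \<le> k * card X"
  using sum_bounded_above[of X "\<lambda>v. min k (card (neighbours G v - S))" k]
  unfolding weight_def by (simp add: mult.commute)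

lemma card_le_weight:
  assumes "is_graph G" "0 < k" "X \<subseteq> boundary G S"
  shows "card X \<le> weight k G S X"
proof -
  have "1 \<le> min k (card (neighbours G v - S))" if "v \<in> X" for v
  proof -
    have "neighbours G v - S \<noteq> {}" using that assms(3) unfolding boundary_def by auto
    then have "card (neighbours G v - S) > 0"
      using finite_neighbours[OF assms(1)] by (simp add: card_gt_0_iff)
    then show ?thesis using assms(2) by simp
  qed
  then have "(\<Sum>v\<in>X. 1) \<le> weight k G S X" unfolding weight_def by (rule sum_mono)
  then show ?thesis by simp
qed

lemma weight_boundary_le:
  assumes "finite S"
  shows "weight k G S (boundary G S) \<le> weight k G S S"
  using assms unfolding weight_def boundary_def by (rule sum_mono2) auto

section \<open>Cutting a light set along a small cutset\<close>

lemma cut_partition_commute: "cut_partition G A B C \<longleftrightarrow> cut_partition G B A C"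
proof -
  have "cut_partition G Q P C" if "cut_partition G P Q C" for P Q
    using that insert_commute unfolding cut_partition_def by (metis Int_commute Un_commute)
  then show ?thesis by blast
qed

lemma cut_partition_induced_disjoint_neighbours:
  assumes "cut_partition (induced G S) A B C" "v \<in> A"
  shows "neighbours G v \<inter> B = {}"
proof (rule ccontr)
  assume "neighbours G v \<inter> B \<noteq> {}"
  then obtain b where b: "b \<in> B" "{v, b} \<in> edges G"
    unfolding neighbours_def by (auto simp: insert_commute)
  have "{v, b} \<subseteq> S" "{v, b} \<notin> edges (induced G S)"
    using assms b(1) unfolding cut_partition_def by (auto simp: induced_def)
  with b(2) show False by (simp add: induced_def)
qed

lemma cut_partition_inducedD:
  assumes "cut_partition (induced G S) A B C" "finite S"
  shows "S = A \<union> B \<union> C" "A \<inter> B = {}" "A \<inter> C = {}" "B \<inter> C = {}" "A \<noteq> {}" "B \<noteq> {}"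
    "finite A" "finite B" "finite C"
  using assms unfolding cut_partition_def by (auto simp: induced_def)

text \<open>The boundary status of a vertex of \<open>A\<close> does not change when \<open>B\<close> is discarded.\<close>

lemma neighbours_outside_side:
  assumes "cut_partition (induced G S) A B C" "finite S" "v \<in> A"
  shows "neighbours G v - (A \<union> C) = neighbours G v - S"
  using cut_partition_induced_disjoint_neighbours[OF assms(1,3)]
    cut_partition_inducedD(1)[OF assms(1,2)] by blast

lemma weight_side:
  assumes "cut_partition (induced G S) A B C" "finite S"
  shows "weight k G (A \<union> C) (A \<union> C) = weight k G S A + weight k G (A \<union> C) C"
proof -
  note D = cut_partition_inducedD[OF assms]
  have "weight k G (A \<union> C) A = weight k G S A"
    unfolding weight_def by (rule sum.cong) (simp_all add: neighbours_outside_side[OF assms])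
  then show ?thesis using weight_Un[OF D(7,9,3)] by simp
qed

text \<open>A vertex of \<open>C\<close> gains at most \<open>card B\<close> outside neighbours, and its weight never exceeds
  \<open>k\<close>.\<close>

lemma weight_cutset_after_cut:
  assumes "is_graph G" "cut_partition (induced G S) A B C" "finite S" "card C \<le> k"
  shows "weight k G (A \<union> C) C \<le> weight k G S C + k * min k (card B)"
proof -
  note D = cut_partition_inducedD[OF assms(2,3)]
  have "min k (card (neighbours G v - (A \<union> C)))
      \<le> min k (card (neighbours G v - S)) + min k (card B)" for v
  proof -
    have "neighbours G v - (A \<union> C) \<subseteq> (neighbours G v - S) \<union> B" using D(1) by blast
    then have "card (neighbours G v - (A \<union> C)) \<le> card ((neighbours G v - S) \<union> B)"
      using D(8) finite_neighbours[OF assms(1)] by (intro card_mono) auto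
    also have "\<dots> \<le> card (neighbours G v - S) + card B" by (rule card_Un_le)
    finally show ?thesis by linarith
  qed
  then have "weight k G (A \<union> C) C
      \<le> (\<Sum>v\<in>C. min k (card (neighbours G v - S)) + min k (card B))"
    unfolding weight_def by (rule sum_mono)
  also have "\<dots> = weight k G S C + card C * min k (card B)"
    unfolding weight_def by (simp add: sum.distrib)
  also have "\<dots> \<le> weight k G S C + k * min k (card B)"
    using assms(4) by (simp add: mult_le_mono1)
  finally show ?thesis .
qed

text \<open>If every vertex of \<open>B\<close> has at least \<open>k\<close> neighbours outside \<open>S\<close>, then \<open>B\<close> weighs
  \<open>k * card B\<close>. Otherwise some vertex of \<open>B\<close> has fewer; as at most \<open>k\<close> of its
  neighbours lie in \<open>C\<close>, at least \<open>2 * k\<^sup>2 - 2 * k + 1\<close> of them lie in \<open>B\<close>, and already the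
  size of \<open>B\<close> is at least \<open>k\<^sup>2\<close>.\<close>

lemma boundary_side_heavy:
  assumes "is_graph G" "0 < k" and deg: "\<And>v. v \<in> verts G \<Longrightarrow> 2 * k\<^sup>2 \<le> degree G v"
    and "S \<subseteq> verts G" "finite S" and cut: "cut_partition (induced G S) A B C"
    and C: "card C \<le> k" and B: "B \<subseteq> boundary G S"
  shows "k * min k (card B) \<le> weight k G S B"
proof (cases "\<forall>v\<in>B. k \<le> card (neighbours G v - S)")
  case True
  then have "weight k G S B = k * card B" unfolding weight_def by simp
  then show ?thesis by simp
next
  case False
  then obtain v where v: "v \<in> B" "card (neighbours G v - S) < k" by auto
  note D = cut_partition_inducedD[OF cut assms(5)]
  have "neighbours G v \<inter> A = {}"
    using cut_partition_induced_disjoint_neighbours v(1) cut cut_partition_commute by metis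
  then have sub: "neighbours G v \<subseteq> (neighbours G v - S) \<union> ((B - {v}) \<union> C)"
    using D(1) not_self_neighbour[OF assms(1)] by blast
  have "v \<in> verts G" using v(1) D(1) assms(4) by blast
  then have "2 * k\<^sup>2 \<le> card (neighbours G v)"
    using deg degree_eq_card_neighbours[OF assms(1)] by metis
  also have "\<dots> \<le> card ((neighbours G v - S) \<union> ((B - {v}) \<union> C))"
    using sub finite_neighbours[OF assms(1)] D(8,9) by (intro card_mono) auto
  also have "\<dots> \<le> card (neighbours G v - S) + (card (B - {v}) + card C)"
    by (meson add_left_mono card_Un_le order_trans)
  finally have "2 * k\<^sup>2 \<le> card (neighbours G v - S) + (card (B - {v}) + card C)" .
  moreover have "card B > 0" using v(1) D(8) by (auto simp: card_gt_0_iff)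
  moreover have "card (B - {v}) = card B - 1" using v(1) D(8) by simp
  ultimately have large: "2 * k\<^sup>2 + 2 \<le> card B + 2 * k" using v(2) C by linarith
  obtain m where m: "k = Suc m" using assms(2) gr0_implies_Suc by blast
  have "k * k \<le> card B" using large by (simp add: m power2_eq_square algebra_simps)
  also have "\<dots> \<le> weight k G S B" by (rule card_le_weight[OF assms(1,2) B])
  finally show ?thesis by (meson min.cobounded1 mult_le_mono2 order_trans)
qed

text \<open>A vertex with all its neighbours in \<open>S\<close> forces more than \<open>2 * k\<^sup>2\<close> vertices into \<open>S\<close>,
  of which at most \<open>k\<close> are in \<open>C\<close>. Two boundary sides would have to be so large in total that
  \<open>S\<close> would not be light: each boundary vertex weighs at least \<open>1\<close>, and a side with fewer
  than \<open>k\<close> vertices weighs \<open>k\<close> times its size.\<close>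

lemma not_both_sides_in_boundary:
  assumes "is_graph G" "0 < k" and deg: "\<And>v. v \<in> verts G \<Longrightarrow> 2 * k\<^sup>2 \<le> degree G v"
    and S: "S \<subseteq> verts G" "finite S" and int: "x \<in> S" "x \<notin> boundary G S"
    and light: "weight k G S S < 2 * k\<^sup>2"
    and cut: "cut_partition (induced G S) A B C" and C: "card C \<le> k"
  shows "\<not> (A \<subseteq> boundary G S \<and> B \<subseteq> boundary G S)"
proof
  assume both: "A \<subseteq> boundary G S \<and> B \<subseteq> boundary G S"
  note D = cut_partition_inducedD[OF cut S(2)]
  have cut': "cut_partition (induced G S) B A C" using cut cut_partition_commute by blast
  have heavy: "k * min k (card A) \<le> weight k G S A" "k * min k (card B) \<le> weight k G S B"
    using boundary_side_heavy[OF assms(1-3) S cut' C] boundary_side_heavy[OF assms(1-3) S cut C]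
      both by auto
  have ge: "card A \<le> weight k G S A" "card B \<le> weight k G S B"
    using card_le_weight[OF assms(1,2)] both by auto
  have sum: "weight k G S A + weight k G S B \<le> weight k G S S"
    using weight_Un[OF D(7,8,2), of k G S] D(1) S(2)
      sum_mono2[of S "A \<union> B" "\<lambda>v. min k (card (neighbours G v - S))"]
    unfolding weight_def by auto
  have pos: "0 < card A" "0 < card B" using D by (auto simp: card_gt_0_iff)
  have "neighbours G x \<subseteq> S - {x}"
    using int not_self_neighbour[OF assms(1)] unfolding boundary_def by blast
  then have "card (neighbours G x) \<le> card (S - {x})" using S(2) by (intro card_mono) auto
  moreover have "card (S - {x}) < card S" using int(1) S(2) by (rule card_Diff1_less[rotated])
  moreover have "2 * k\<^sup>2 \<le> card (neighbours G x)"
    using deg[of x] int(1) S(1) degree_eq_card_neighbours[OF assms(1)] by auto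
  moreover have "card S = card A + card B + card C"
    unfolding D(1) using D(2-4,7-9) by (subst card_Un_disjoint; auto simp: card_Un_disjoint)
  ultimately have large: "2 * k\<^sup>2 < card A + card B + k" using C by linarith
  obtain m where m: "k = Suc m" using assms(2) gr0_implies_Suc by blast
  \<comment> \<open>A small side of size \<open>a\<close> weighs \<open>a + (k - 1) * a \<ge> a + (k - 1)\<close>, which makes up for \<open>C\<close>.\<close>
  have gain: "c + m \<le> k * min k c" if "c < k" "0 < c" for c
  proof -
    have "m * 1 \<le> m * c" using that by (intro mult_le_mono2) simp
    then show ?thesis using that(1) m by (simp add: min_def)
  qed
  consider "card A < k" | "card B < k" | "k \<le> card A" "k \<le> card B" by linarith
  then show False
  proof cases
    case 1
    then show ?thesis using gain[of "card A"] pos heavy(1) ge(2) sum light large m by linarith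
  next
    case 2
    then show ?thesis using gain[of "card B"] pos heavy(2) ge(1) sum light large m by linarith
  next
    case 3
    then have "k * k \<le> weight k G S A" "k * k \<le> weight k G S B" using heavy by simp_all
    then show ?thesis using sum light by (simp add: power2_eq_square)
  qed
qed

text \<open>One side suffices here, because the two sides play symmetric roles: \<open>B\<close> is the side to
  be discarded, either as the heavier one or as a part of the boundary.\<close>

lemma light_side:
  assumes "is_graph G" "0 < k" and deg: "\<And>v. v \<in> verts G \<Longrightarrow> 2 * k\<^sup>2 \<le> degree G v"
    and S: "S \<subseteq> verts G" "finite S" and light: "weight k G S S < 2 * k\<^sup>2"
    and cut: "cut_partition (induced G S) A B C" and C: "card C \<le> k"
    and disj: "weight k G S A \<le> weight k G S B \<or> B \<subseteq> boundary G S"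
  shows "weight k G (A \<union> C) (A \<union> C) < 2 * k\<^sup>2"
proof -
  note D = cut_partition_inducedD[OF cut S(2)]
  have "weight k G S (A \<union> B \<union> C) = weight k G S (A \<union> B) + weight k G S C"
    by (rule weight_Un) (use D(3,4,7-9) in auto)
  then have total: "weight k G S S = weight k G S A + weight k G S B + weight k G S C"
    using weight_Un[OF D(7,8,2)] D(1) by metis
  have side: "weight k G (A \<union> C) (A \<union> C) = weight k G S A + weight k G (A \<union> C) C"
    by (rule weight_side[OF cut S(2)])
  from disj show ?thesis
  proof
    assume "weight k G S A \<le> weight k G S B"
    moreover have "weight k G (A \<union> C) C \<le> k * card C" by (rule weight_le)
    moreover have "k * card C \<le> k * k" using C by simp
    ultimately show ?thesis
      using side total light unfolding power2_eq_square by linarith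
  next
    assume "B \<subseteq> boundary G S"
    then show ?thesis
      using boundary_side_heavy[OF assms(1-3) S cut C]
        weight_cutset_after_cut[OF assms(1) cut S(2) C] side total light by linarith
  qed
qed

text \<open>At most one of two sides lies in the boundary. That side is discarded, if there
  is one, and otherwise the heavier side is. Then the kept side has an interior vertex, and this
  stays interior.\<close>

lemma cut_light_set:
  assumes "is_graph G" "0 < k" and deg: "\<And>v. v \<in> verts G \<Longrightarrow> 2 * k\<^sup>2 \<le> degree G v"
    and S: "S \<subseteq> verts G" "finite S" and int: "\<not> S \<subseteq> boundary G S"
    and light: "weight k G S S < 2 * k\<^sup>2"
    and cut: "cut_partition (induced G S) A B C" and C: "card C \<le> k"
  obtains T where "T \<subset> S" "\<not> T \<subseteq> boundary G T" "weight k G T T < 2 * k\<^sup>2"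
proof -
  note smaller = that
  have keep: thesis
    if c: "cut_partition (induced G S) P Q C" and P: "\<not> P \<subseteq> boundary G S"
      and Q: "weight k G S P \<le> weight k G S Q \<or> Q \<subseteq> boundary G S" for P Q
  proof -
    note D = cut_partition_inducedD[OF c S(2)]
    obtain y where "y \<in> P" "y \<notin> boundary G S" using P by blast
    then have "y \<in> P" "neighbours G y - S = {}" using D(1) unfolding boundary_def by auto
    then have "y \<in> P \<union> C" "neighbours G y \<subseteq> P \<union> C"
      using neighbours_outside_side[OF c S(2)] by auto
    then have "y \<in> P \<union> C" "y \<notin> boundary G (P \<union> C)" unfolding boundary_def by auto
    then have "\<not> P \<union> C \<subseteq> boundary G (P \<union> C)" by blast
    moreover have "P \<union> C \<subset> S" using D(1,2,4,6) by blast
    moreover have "weight k G (P \<union> C) (P \<union> C) < 2 * k\<^sup>2"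
      by (rule light_side[OF assms(1-3) S light c C Q])
    ultimately show thesis by (intro smaller)
  qed
  have cut': "cut_partition (induced G S) B A C" using cut cut_partition_commute by blast
  obtain x where x: "x \<in> S" "x \<notin> boundary G S" using int by blast
  have "\<not> (A \<subseteq> boundary G S \<and> B \<subseteq> boundary G S)"
    by (rule not_both_sides_in_boundary[OF assms(1-3) S x light cut C])
  then consider "\<not> A \<subseteq> boundary G S" "B \<subseteq> boundary G S"
    | "\<not> B \<subseteq> boundary G S" "A \<subseteq> boundary G S"
    | "\<not> A \<subseteq> boundary G S" "\<not> B \<subseteq> boundary G S" by blast
  then show thesis
  proof cases
    case 1
    then show thesis by (intro keep[OF cut] disjI2)
  next
    case 2
    then show thesis by (intro keep[OF cut'] disjI2)
  next
    case 3
    show thesis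
    proof (cases "weight k G S A \<le> weight k G S B")
      case True
      then show thesis by (intro keep[OF cut 3(1)] disjI1)
    next
      case False
      then show thesis by (intro keep[OF cut' 3(2)] disjI1) simp
    qed
  qed
qed

text \<open>The descent starts at the whole vertex set, whose weight is \<open>0\<close>. It has to preserve an
  interior vertex: a single vertex weighs
  at most \<open>k\<close>, so it always forms a light set, and this has no cut-partition.\<close>

theorem isolated_uncut_set:
  assumes "is_graph G" "0 < k" and deg: "\<And>v. v \<in> verts G \<Longrightarrow> 2 * k\<^sup>2 \<le> degree G v"
  obtains S where "S \<subseteq> verts G" "\<not> S \<subseteq> boundary G S" "card (boundary G S) < 2 * k\<^sup>2"
    "\<And>A B C. cut_partition (induced G S) A B C \<Longrightarrow> k < card C"
proof -
  define good where
    "good S \<longleftrightarrow> S \<subseteq> verts G \<and> \<not> S \<subseteq> boundary G S \<and> weight k G S S < 2 * k\<^sup>2" for S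
  have fin: "finite (verts G)" using assms(1) unfolding is_graph_def by blast
  have nb: "neighbours G v - verts G = {}" for v using neighbours_subset[OF assms(1)] by blast
  have "boundary G (verts G) = {}" using nb unfolding boundary_def by blast
  moreover have "verts G \<noteq> {}" using assms(1) unfolding is_graph_def by blast
  ultimately have "good (verts G)"
    using assms(2) unfolding good_def weight_def by (simp add: nb)
  then obtain S where S: "good S" and least: "\<And>T. good T \<Longrightarrow> card S \<le> card T"
    using ex_has_least_nat[of good _ card] by blast
  have finS: "finite S" using S fin finite_subset unfolding good_def by blast
  have "card (boundary G S) \<le> weight k G S (boundary G S)"
    by (rule card_le_weight[OF assms(1,2)]) simp
  also have "\<dots> \<le> weight k G S S" by (rule weight_boundary_le[OF finS])
  finally have bd: "card (boundary G S) < 2 * k\<^sup>2" using S unfolding good_def by linarith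
  have "k < card C" if cut: "cut_partition (induced G S) A B C" for A B C
  proof (rule ccontr)
    assume "\<not> k < card C"
    then have C: "card C \<le> k" by simp
    obtain T where T: "T \<subset> S" "\<not> T \<subseteq> boundary G T" "weight k G T T < 2 * k\<^sup>2"
      using cut_light_set[OF assms _ finS _ _ cut C] S unfolding good_def by blast
    then have "good T" using S unfolding good_def by blast
    then show False using least psubset_card_mono[OF finS T(1)] by fastforce
  qed
  then show thesis using that S bd unfolding good_def by blast
qed

section \<open>Induced subgraphs in the closure\<close>

lemma is_graph_glued:
  assumes "is_graph G1" "is_graph G2" "glued k G1 G2 G"
  shows "is_graph G"
proof -
  have "e \<subseteq> verts G1 \<union> verts G2 \<and> card e = 2" if "e \<in> edges G1 \<union> edges G2" for e
    using that
  proof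
    assume "e \<in> edges G1"
    then have "e \<subseteq> verts G1" "card e = 2" using assms(1) unfolding is_graph_def by blast+
    then show ?thesis by blast
  next
    assume "e \<in> edges G2"
    then have "e \<subseteq> verts G2" "card e = 2" using assms(2) unfolding is_graph_def by blast+
    then show ?thesis by blast
  qed
  moreover have "finite (verts G1)" "finite (verts G2)" "verts G1 \<noteq> {}"
    using assms(1,2) unfolding is_graph_def by blast+
  moreover have "verts G = verts G1 \<union> verts G2" "edges G = edges G1 \<union> edges G2"
    using assms(3) unfolding glued_def by simp_all
  ultimately show ?thesis unfolding is_graph_def by simp
qed

lemma is_graph_closure:
  assumes "hereditary \<G>" "G \<in> closure k \<G>"
  shows "is_graph G"
  using assms(2)
proof induction
  case (base G)
  then show ?case using assms(1) unfolding hereditary_def by (elim conjE) (erule bspec)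
next
  case (glue G1 G2 G)
  then show ?case using is_graph_glued by blast
qed

lemma glued_commute: "glued k G1 G2 G \<longleftrightarrow> glued k G2 G1 G"
  unfolding glued_def Int_commute[of "verts G2" "verts G1"] Un_commute[of "verts G2" "verts G1"]
    Un_commute[of "edges G2" "edges G1"]
  by (rule conj_cong[OF eq_commute refl])

lemma induced_glued_left:
  assumes "is_graph G2" "glued k G1 G2 G" "S \<subseteq> verts G1"
  shows "induced G S = induced G1 S"
proof -
  have "e \<in> edges G1" if "e \<in> edges G2" "e \<subseteq> S" for e
  proof -
    have "e \<subseteq> verts G1 \<inter> verts G2" using that assms(1,3) unfolding is_graph_def by blast
    then have "e \<in> edges (induced G2 (verts G1 \<inter> verts G2))"
      using that(1) by (simp add: induced_def)
    also have "\<dots> = edges (induced G1 (verts G1 \<inter> verts G2))"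
      using assms(2) by (simp add: glued_def)
    finally show ?thesis by (simp add: induced_def)
  qed
  then show ?thesis using assms(2) unfolding glued_def induced_def by auto
qed

text \<open>A set inside one of the two glued graphs is left to the induction hypothesis, and a set
  that meets both sides is cut by the vertices along which the graphs are glued. Stating this for
  all induced subgraphs at once avoids a separate proof that the closure is
  hereditary.\<close>

lemma induced_closure_cases:
  assumes "hereditary \<G>" "G \<in> closure k \<G>" "S \<subseteq> verts G" "S \<noteq> {}"
  shows "induced G S \<in> \<G> \<or> (\<exists>A B C. cut_partition (induced G S) A B C \<and> card C \<le> k)"
  using assms(2-4)
proof induction
  case (base G)
  have "\<forall>G\<in>\<G>. \<forall>S. S \<subseteq> verts G \<and> S \<noteq> {} \<longrightarrow> induced G S \<in> \<G>"
    using assms(1) unfolding hereditary_def by (elim conjE)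
  with base show ?case by blast
next
  case (glue G1 G2 G)
  have g: "is_graph G1" "is_graph G2"
    using glue.hyps(1,2) by (auto intro: is_graph_closure[OF assms(1)])
  consider "S \<subseteq> verts G1" | "S \<subseteq> verts G2" | "S - verts G2 \<noteq> {}" "S - verts G1 \<noteq> {}" by blast
  then show ?case
  proof cases
    case 1
    then have "induced G S = induced G1 S" by (rule induced_glued_left[OF g(2) glue.hyps(3)])
    then show ?thesis using glue.IH(1)[OF 1 glue.prems(2)] by (simp only:)
  next
    case 2
    have "glued k G2 G1 G" using glue.hyps(3) glued_commute by blast
    with 2 have "induced G S = induced G2 S" by (intro induced_glued_left[OF g(1)])
    then show ?thesis using glue.IH(2)[OF 2 glue.prems(2)] by (simp only:)
  next
    case 3
    let ?C = "S \<inter> verts G1 \<inter> verts G2"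
    have vG: "verts G = verts G1 \<union> verts G2" and eG: "edges G = edges G1 \<union> edges G2"
      and small: "card (verts G1 \<inter> verts G2) \<le> k"
      using glue.hyps(3) unfolding glued_def by simp_all
    have "{a, b} \<notin> edges G" if "a \<in> S - verts G2" "b \<in> S - verts G1" for a b
    proof -
      have "\<forall>e\<in>edges G1. e \<subseteq> verts G1" "\<forall>e\<in>edges G2. e \<subseteq> verts G2"
        using g unfolding is_graph_def by simp_all
      then have "{a, b} \<notin> edges G1" "{a, b} \<notin> edges G2" using that by auto
      then show ?thesis using eG by simp
    qed
    moreover have "S \<subseteq> verts G1 \<union> verts G2" using glue.prems(1) vG by simp
    ultimately have "cut_partition (induced G S) (S - verts G2) (S - verts G1) ?C"
      using 3 unfolding cut_partition_def induced_def graph.simps by blast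
    moreover have "finite (verts G1)" using g(1) unfolding is_graph_def by (elim conjE)
    then have "card ?C \<le> card (verts G1 \<inter> verts G2)" by (intro card_mono) auto
    then have "card ?C \<le> k" using small by (rule order_trans)
    ultimately show ?thesis by (intro disjI2 exI conjI)
  qed
qed

section \<open>Decomposing graphs in the closure\<close>

lemma induced_verts:
  assumes "is_graph G"
  shows "induced G (verts G) = G"
proof -
  have "{e \<in> edges G. e \<subseteq> verts G} = edges G" using assms unfolding is_graph_def by blast
  then show ?thesis unfolding induced_def by simp
qed

lemma cut_partition_boundary:
  assumes "S \<subset> verts G" "\<not> S \<subseteq> boundary G S"
  shows "cut_partition G (S - boundary G S) (verts G - S) (boundary G S)"
proof -
  have "{a, b} \<notin> edges G" if "a \<in> S - boundary G S" "b \<in> verts G - S" for a b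
  proof
    assume "{a, b} \<in> edges G"
    then have "b \<in> neighbours G a" unfolding neighbours_def by (simp add: insert_commute)
    then show False using that unfolding boundary_def by blast
  qed
  moreover have "boundary G S \<subseteq> S" unfolding boundary_def by blast
  ultimately show ?thesis using assms unfolding cut_partition_def by blast
qed

theorem theorem2p7:
  fixes k :: nat and \<G> :: "'a graph set" and G :: "'a graph"
  assumes "k > 0"
    and "hereditary \<G>"
    and "G \<in> closure k \<G>"
  shows "G \<in> \<G> \<or>
    (\<exists>A B C. cut_partition G A B C \<and> induced G (A \<union> C) \<in> \<G> \<and> card C \<le> 2 * k\<^sup>2 - 1) \<or>
    (\<exists>v\<in>verts G. degree G v \<le> 2 * k\<^sup>2 - 1)"
proof (cases "\<exists>v\<in>verts G. degree G v \<le> 2 * k\<^sup>2 - 1")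
  case True
  then show ?thesis by blast
next
  case False
  have G: "is_graph G" using is_graph_closure assms(2,3) by blast
  have "2 * k\<^sup>2 \<le> degree G v" if "v \<in> verts G" for v using False that by force
  then obtain S where S: "S \<subseteq> verts G" "\<not> S \<subseteq> boundary G S" "card (boundary G S) < 2 * k\<^sup>2"
    and uncut: "\<And>A B C. cut_partition (induced G S) A B C \<Longrightarrow> k < card C"
    using isolated_uncut_set[OF G assms(1)] by metis
  have "S \<noteq> {}" using S(2) by blast
  then have mem: "induced G S \<in> \<G>"
    using induced_closure_cases[OF assms(2,3) S(1)] uncut leD by blast
  show ?thesis
  proof (cases "S = verts G")
    case True
    then show ?thesis using mem induced_verts[OF G] by simp
  next
    case False
    then have "cut_partition G (S - boundary G S) (verts G - S) (boundary G S)"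
      using S(1,2) by (intro cut_partition_boundary psubsetI)
    moreover have "S - boundary G S \<union> boundary G S = S" unfolding boundary_def by blast
    moreover have "card (boundary G S) \<le> 2 * k\<^sup>2 - 1" using S(3) by linarith
    ultimately show ?thesis using mem by metis
  qed
qed

end
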